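(* Let $N\ge2$, $m_1,\dots,m_N\in\{+1,-1\}$, and let $\mathbf X(t)=(\mathbf x_1(t),\dots,\mathbf x_N(t))$, $0\le t<T_{\max}$, be the solution of $$\dot{\mathbf x}_j(t)=2m_j\sum_{k=1,k\ne j}^N m_k\frac{\mathbf x_j(t)-\mathbf x_k(t)}{|\mathbf x_j(t)-\mathbf x_k(t)|^2},\qquad 1\le j\le N,\qquad \mathbf X(0)=\mathbf X^0\in\mathbb R_*^{2\times N}.$$ If $\mathbf X^0$ is collinear, i.e. there exist $\mathbf x^0\in\mathbb R^2$ and a unit vector $\mathbf e\in\mathbb R^2$ such that $\mathbf X^0\in S_{\mathbf e}(\mathbf x^0)$, then the solution is collinear, i.e. $\mathbf X(t)\in S_{\mathbf e}(\mathbf x^0)$ for all $0\le t<T_{\max}$.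
   Context: $\mathbb R_*^{2\times N}:=\{(\mathbf x_1,\dots,\mathbf x_N)\in\mathbb R^{2\times N} : \mathbf x_j\neq\mathbf x_l\in\mathbb R^2 \text{ for } 1\le j<l\le N\}$. $S_{\mathbf e}(\mathbf x^0):=\{\mathbf X=(\mathbf x_1,\dots,\mathbf x_N)\in\mathbb R_*^{2\times N} : |(\mathbf x_j-\mathbf x^0)\cdot\mathbf e|=|\mathbf x_j-\mathbf x^0|\,|\mathbf e|,\ 1\le j\le N\}$, i.e. all $\mathbf x_j$ lie on the line through $\mathbf x^0$ parallel to $\mathbf e$. $T_{\max}:=\sup\{t\ge 0 : \mathbf x_j(t)\ne\mathbf x_l(t)\text{ for all }1\le j\ne l\le N\}\in(0,+\infty]$. *)

theory Defs
  imports "HOL-Analysis.Analysis"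
begin

text \<open>A configuration of \<open>N\<close> vortices is an element of \<open>real^2^'n\<close> with \<open>N = CARD('n)\<close>;
  \<open>X $ j\<close> is the position of the \<open>j\<close>-th vortex.\<close>

definition collision_free :: "(real^2^'n) set" where
  "collision_free = {X. \<forall>j l. j \<noteq> l \<longrightarrow> X $ j \<noteq> X $ l}"

definition collinear_configs :: "real^2 \<Rightarrow> real^2 \<Rightarrow> (real^2^'n) set" where
  "collinear_configs e x0 =
     {X \<in> collision_free. \<forall>j. \<bar>(X $ j - x0) \<bullet> e\<bar> = norm (X $ j - x0) * norm e}"

definition vortex_velocity :: "('n::finite \<Rightarrow> real) \<Rightarrow> real^2^'n \<Rightarrow> 'n \<Rightarrow> real^2" where
  "vortex_velocity m X j =
     (2 * m j) *\<^sub>R (\<Sum>k\<in>UNIV - {j}. m k *\<^sub>R ((X $ j - X $ k) /\<^sub>R (norm (X $ j - X $ k))\<^sup>2))"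

definition T_max :: "(real \<Rightarrow> real^2^'n) \<Rightarrow> ereal" where
  "T_max X = Sup {ereal t |t. 0 \<le> t \<and> X t \<in> collision_free}"

text \<open>The trajectory \<open>X\<close> is a total function, but it represents a solution that lives on
  \<open>[0, T_max X)\<close> only. A solution with lifespan \<open>T\<close> is represented by any extension whose values
  at times \<open>t \<ge> T\<close> are not collision free, for instance by \<open>0\<close>; then \<open>T_max X = T\<close>.
  Since \<open>t < T_max X\<close>, the derivative within \<open>{0..}\<close> is the one-sided derivative at \<open>t = 0\<close>
  and the ordinary derivative at \<open>t > 0\<close>. Solutions stay in the domain of the vector field, so
  freedom of collisions is required explicitly; division by zero never occurs.\<close>

definition vortex_solution ::
    "('n::finite \<Rightarrow> real) \<Rightarrow> real^2^'n \<Rightarrow> (real \<Rightarrow> real^2^'n) \<Rightarrow> bool" where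
  "vortex_solution m X0 X \<longleftrightarrow>
     X 0 = X0 \<and>
     (\<forall>t. 0 \<le> t \<and> ereal t < T_max X \<longrightarrow>
        X t \<in> collision_free \<and>
        (\<forall>j. ((\<lambda>s. X s $ j) has_vector_derivative vortex_velocity m (X t) j) (at t within {0..})))"

end

theory Submission
  imports Defs
begin

text \<open>The components \<open>y\<^sub>j\<close> of \<open>x\<^sub>j - x\<^sup>0\<close> orthogonal to \<open>e\<close> satisfy the linear system
  \<open>y\<^sub>j' = 2 m\<^sub>j \<Sum>\<^sub>k m\<^sub>k (y\<^sub>j - y\<^sub>k) / |x\<^sub>j - x\<^sub>k|\<^sup>2\<close>. On a compact time interval before the first
  collision its coefficients are bounded, so Gronwall's inequality gives \<open>y = 0\<close> from \<open>y(0) = 0\<close>.\<close>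

text \<open>The integrating factor \<open>exp (- C * t)\<close> absorbs the growth rate: the product
  \<open>?F\<close> has derivative \<open>(E' t - C * E t) * exp (- C * t)\<close>, which is
  nonpositive, and its sign is that of \<open>E\<close>. Derivatives are asked for in the open
  interval only; continuity covers the endpoints, as suits a solution whose derivative at time 0 is
  one-sided.\<close>

lemma gronwall_nonpos:
  fixes E :: "real \<Rightarrow> real"
  assumes "a \<le> b" and cont: "continuous_on {a..b} E"
    and deriv: "\<And>t. a < t \<Longrightarrow> t < b \<Longrightarrow> (E has_real_derivative E' t) (at t)"
    and bound: "\<And>t. a < t \<Longrightarrow> t < b \<Longrightarrow> E' t \<le> C * E t"
    and "E a \<le> 0"
  shows "E b \<le> 0"
proof -
  let ?F = "\<lambda>t. E t * exp (- C * t)"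
  have "?F b \<le> ?F a"
  proof (rule DERIV_nonpos_imp_decreasing_open[OF \<open>a \<le> b\<close>])
    fix t assume t: "a < t" "t < b"
    have "(?F has_real_derivative (E' t - C * E t) * exp (- C * t)) (at t)"
      by (auto intro!: derivative_eq_intros deriv[OF t] simp: algebra_simps)
    moreover have "(E' t - C * E t) * exp (- C * t) \<le> 0"
      using bound[OF t] by (simp add: mult_nonpos_nonneg)
    ultimately show "\<exists>y. DERIV ?F t :> y \<and> y \<le> 0" by blast
  qed (intro continuous_intros cont)
  also have "\<dots> \<le> 0" using \<open>E a \<le> 0\<close> by (simp add: mult_nonpos_nonneg)
  finally show ?thesis by (simp add: mult_le_0_iff)
qed

text \<open>The squared norm is used because, unlike the norm, it is differentiable also where
  \<open>y\<close> vanishes. By Cauchy-Schwarz its derivative is at most \<open>2 * C\<close> times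
  itself, so the scalar inequality applies.\<close>

lemma vector_gronwall_zero:
  fixes y :: "real \<Rightarrow> 'a::real_inner"
  assumes "a \<le> b" and cont: "continuous_on {a..b} y"
    and deriv: "\<And>t. a < t \<Longrightarrow> t < b \<Longrightarrow> (y has_vector_derivative y' t) (at t)"
    and bound: "\<And>t. a < t \<Longrightarrow> t < b \<Longrightarrow> norm (y' t) \<le> C * norm (y t)"
    and "y a = 0"
  shows "y b = 0"
proof -
  have "y b \<bullet> y b \<le> 0"
  proof (rule gronwall_nonpos[OF \<open>a \<le> b\<close>, where E = "\<lambda>t. y t \<bullet> y t"
        and E' = "\<lambda>t. 2 * (y t \<bullet> y' t)" and C = "2 * C"])
    fix t assume t: "a < t" "t < b"
    have "((\<lambda>t. y t \<bullet> y t) has_derivative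
        (\<lambda>h. y t \<bullet> (h *\<^sub>R y' t) + (h *\<^sub>R y' t) \<bullet> y t)) (at t)"
      using deriv[OF t] unfolding has_vector_derivative_def by (intro has_derivative_inner)
    then show "((\<lambda>t. y t \<bullet> y t) has_real_derivative 2 * (y t \<bullet> y' t)) (at t)"
      by (rule has_derivative_imp_has_field_derivative)
        (simp add: inner_commute algebra_simps)
    have "y t \<bullet> y' t \<le> norm (y t) * norm (y' t)" by (rule norm_cauchy_schwarz)
    also have "\<dots> \<le> norm (y t) * (C * norm (y t))"
      using bound[OF t] by (rule mult_left_mono) simp
    finally show "2 * (y t \<bullet> y' t) \<le> 2 * C * (y t \<bullet> y t)"
      by (simp add: dot_square_norm power2_eq_square algebra_simps)
  qed (use \<open>y a = 0\<close> in \<open>auto intro!: continuous_intros cont\<close>)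
  then show ?thesis by (metis inner_eq_zero_iff inner_ge_zero order_antisym)
qed

text \<open>This is the equality case of Cauchy-Schwarz in the plane. The vector on the right is
  \<open>e\<close> turned by a right angle, and Lagrange's identity measures the defect by the
  square of the inner product with it. Collinearity thereby becomes a linear condition on
  \<open>v\<close>.\<close>

lemma abs_inner_eq_norm_iff_perp:
  fixes v e :: "real^2"
  shows "\<bar>v \<bullet> e\<bar> = norm v * norm e \<longleftrightarrow> v \<bullet> vector [- (e $ 2), e $ 1] = 0"
proof -
  let ?n = "vector [- (e $ 2), e $ 1] :: real^2"
  have lagrange: "(norm v * norm e)\<^sup>2 = (v \<bullet> e)\<^sup>2 + (v \<bullet> ?n)\<^sup>2"
    by (simp add: power_mult_distrib power2_norm_eq_inner inner_vec_def sum_2)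
      (simp add: algebra_simps power2_eq_square)
  have "\<bar>v \<bullet> e\<bar> = norm v * norm e \<longleftrightarrow> \<bar>v \<bullet> e\<bar>\<^sup>2 = (norm v * norm e)\<^sup>2"
    by (metis abs_ge_zero mult_nonneg_nonneg norm_ge_zero power2_eq_iff_nonneg)
  also have "\<dots> \<longleftrightarrow> v \<bullet> ?n = 0" unfolding lagrange by simp
  finally show ?thesis .
qed

text \<open>This supplies the Gronwall constant. One factor \<open>CARD('n)\<close> counts the terms
  in each component, the other comes from bounding the Euclidean norm by the sum of the absolute
  components; the 2 comes from the difference of two components.\<close>

lemma norm_linear_coupling_le:
  fixes y :: "real^'n" and c :: "'n::finite \<Rightarrow> 'n \<Rightarrow> real"
  assumes c: "\<And>j k. j \<noteq> k \<Longrightarrow> \<bar>c j k\<bar> \<le> A" and "0 \<le> A"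
  shows "norm (\<chi> j. \<Sum>k\<in>UNIV - {j}. c j k * (y $ j - y $ k))
      \<le> real CARD('n) * (real CARD('n) * (A * 2)) * norm y"
proof -
  have "\<bar>\<Sum>k\<in>UNIV - {j}. c j k * (y $ j - y $ k)\<bar> \<le> real CARD('n) * (A * 2 * norm y)" for j
  proof -
    have "\<bar>\<Sum>k\<in>UNIV - {j}. c j k * (y $ j - y $ k)\<bar>
        \<le> (\<Sum>k\<in>UNIV - {j}. \<bar>c j k * (y $ j - y $ k)\<bar>)"
      by (rule sum_abs)
    also have "\<dots> \<le> real (card (UNIV - {j})) * (A * 2 * norm y)"
    proof (rule sum_bounded_above)
      fix k assume "k \<in> UNIV - {j}"
      then have "\<bar>c j k\<bar> \<le> A" using c by auto
      moreover have "\<bar>y $ j - y $ k\<bar> \<le> 2 * norm y"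
        using component_le_norm_cart[of y j] component_le_norm_cart[of y k] by linarith
      ultimately show "\<bar>c j k * (y $ j - y $ k)\<bar> \<le> A * 2 * norm y"
        unfolding abs_mult mult.assoc using \<open>0 \<le> A\<close> by (intro mult_mono) auto
    qed
    also have "\<dots> \<le> real CARD('n) * (A * 2 * norm y)"
      using \<open>0 \<le> A\<close> by (intro mult_right_mono) (auto intro!: card_mono)
    finally show ?thesis .
  qed
  then have "(\<Sum>j\<in>UNIV. \<bar>(\<chi> j. \<Sum>k\<in>UNIV - {j}. c j k * (y $ j - y $ k)) $ j\<bar>)
      \<le> real CARD('n) * (real CARD('n) * (A * 2 * norm y))"
    by (intro sum_bounded_above) simp
  then show ?thesis
    unfolding mult.assoc by (rule order_trans[OF norm_le_l1_cart])
qed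

lemma vortex_solution_at:
  assumes "vortex_solution m X0 X" and "0 \<le> t" and "ereal t < T_max X"
  shows "X t \<in> collision_free"
    and "((\<lambda>s. X s $ j) has_vector_derivative vortex_velocity m (X t) j) (at t within {0..})"
  using assms unfolding vortex_solution_def by blast+

theorem lemma2p2:
  fixes m :: "'n::finite \<Rightarrow> real"
    and X :: "real \<Rightarrow> real^2^'n"
    and X0 :: "real^2^'n"
    and x0 e :: "real^2"
  assumes "CARD('n) \<ge> 2"
    and "\<forall>j. m j \<in> {1, -1}"
    and "X0 \<in> collision_free"
    and "vortex_solution m X0 X"
    and "norm e = 1"
    and "X0 \<in> collinear_configs e x0"
  shows "\<forall>t. 0 \<le> t \<and> ereal t < T_max X \<longrightarrow> X t \<in> collinear_configs e x0"
proof (intro allI impI, elim conjE)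
  fix T assume T: "0 \<le> T" "ereal T < T_max X"
  define n :: "real^2" where "n = vector [- (e $ 2), e $ 1]"
  define y :: "real \<Rightarrow> real^'n" where "y = (\<lambda>t. \<chi> j. (X t $ j - x0) \<bullet> n)"
  \<comment> \<open>Evaluating these weights along the given trajectory turns the nonlinear equation
    into a linear system for \<open>y\<close> with time-dependent coefficients.\<close>
  define c where "c = (\<lambda>t j k. 2 * m j * m k / (norm (X t $ j - X t $ k))\<^sup>2)"
  have X: "X t \<in> collision_free"
    "((\<lambda>s. X s $ j) has_vector_derivative vortex_velocity m (X t) j) (at t within {0..})"
    if "t \<in> {0..T}" for t j
  proof -
    have "ereal t < T_max X" using that T(2) by (auto intro: le_less_trans[rotated])
    then show "X t \<in> collision_free"
      "((\<lambda>s. X s $ j) has_vector_derivative vortex_velocity m (X t) j) (at t within {0..})"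
      using vortex_solution_at[OF assms(4)] that by auto
  qed
  have contX: "continuous_on {0..T} (\<lambda>t. X t $ j)" for j
    unfolding continuous_on_eq_continuous_within
    by (auto intro!: continuous_within_subset[OF has_vector_derivative_continuous[OF X(2)]])
  \<comment> \<open>Adding up all pairs lets a single compactness argument bound every coefficient
    at once. Continuity holds because the denominators do not vanish on \<open>{0..T}\<close>, where
    no collision occurs.\<close>
  have "continuous_on {0..T} (\<lambda>t. \<Sum>j\<in>UNIV. \<Sum>k\<in>UNIV - {j}. \<bar>c t j k\<bar>)"
    unfolding c_def using X(1)
    by (intro continuous_intros contX) (auto simp: collision_free_def)
  then have "bounded ((\<lambda>t. \<Sum>j\<in>UNIV. \<Sum>k\<in>UNIV - {j}. \<bar>c t j k\<bar>) ` {0..T})"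
    by (intro compact_imp_bounded compact_continuous_image) auto
  then obtain A where "0 < A"
    and A: "\<And>t. t \<in> {0..T} \<Longrightarrow> \<bar>\<Sum>j\<in>UNIV. \<Sum>k\<in>UNIV - {j}. \<bar>c t j k\<bar>\<bar> \<le> A"
    unfolding bounded_pos by auto
  have c_le: "\<bar>c t j k\<bar> \<le> A" if "t \<in> {0..T}" "j \<noteq> k" for t j k
  proof -
    have "\<bar>c t j k\<bar> \<le> (\<Sum>k\<in>UNIV - {j}. \<bar>c t j k\<bar>)"
      using that by (intro member_le_sum) auto
    also have "\<dots> \<le> (\<Sum>j\<in>UNIV. \<Sum>k\<in>UNIV - {j}. \<bar>c t j k\<bar>)"
      by (rule member_le_sum[where f = "\<lambda>j. \<Sum>k\<in>UNIV - {j}. \<bar>c t j k\<bar>"])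
        (auto intro: sum_nonneg)
    also have "\<dots> \<le> A" using A[OF that(1)] by linarith
    finally show ?thesis .
  qed
  let ?y' = "\<lambda>t. \<chi> j. \<Sum>k\<in>UNIV - {j}. c t j k * (y t $ j - y t $ k)"
  \<comment> \<open>The base point \<open>x0\<close> cancels in \<open>y t $ j - y t $ k\<close>,
    which leaves the normal component of the difference of the two positions.\<close>
  have velocity: "vortex_velocity m (X t) j \<bullet> n = ?y' t $ j" for t j
    unfolding vortex_velocity_def c_def y_def vec_lambda_beta
    by (auto simp: inner_sum_left sum_distrib_left inner_diff_left divide_inverse
        intro!: sum.cong)
  have "y T = 0"
  proof (rule vector_gronwall_zero[OF T(1), where y' = ?y'])
    show "continuous_on {0..T} y"
      unfolding y_def by (intro continuous_intros contX)
    show "y 0 = 0"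
    proof -
      have "X 0 = X0" using assms(4) by (simp add: vortex_solution_def)
      then show ?thesis using assms(6)
        by (simp add: y_def vec_eq_iff[of _ 0] n_def collinear_configs_def abs_inner_eq_norm_iff_perp)
    qed
    fix t assume t: "0 < t" "t < T"
    \<comment> \<open>Such a \<open>t\<close> is interior to the half-line, so the derivative within
      \<open>{0..}\<close> is the ordinary one required by the Gronwall lemma.\<close>
    then have within: "at t within {0..} = at t"
      by (intro at_within_interior) simp
    have "((\<lambda>s. y s $ j) has_vector_derivative ?y' t $ j) (at t)" for j
    proof -
      have "((\<lambda>s. (X s $ j - x0) \<bullet> n) has_vector_derivative vortex_velocity m (X t) j \<bullet> n) (at t)"
        using X(2)[of t j] t
        by (auto simp: within intro!: bounded_linear.has_vector_derivative[OF bounded_linear_inner_left]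
            derivative_eq_intros)
      then show ?thesis unfolding velocity by (simp add: y_def)
    qed
    then show "(y has_vector_derivative ?y' t) (at t)"
      unfolding has_vector_derivative_def
      \<comment> \<open>The basis vectors of \<open>real^'n\<close> are the axis vectors, so the
        componentwise derivatives just found suffice.\<close>
      by (subst has_derivative_componentwise_within)
       (auto simp: Basis_vec_def inner_axis)
    show "norm (?y' t) \<le> real CARD('n) * (real CARD('n) * (A * 2)) * norm (y t)"
      using t \<open>0 < A\<close> by (intro norm_linear_coupling_le c_le) auto
  qed
  then show "X T \<in> collinear_configs e x0"
    using X(1)[of T] T(1)
    by (simp add: collinear_configs_def abs_inner_eq_norm_iff_perp y_def n_def vec_eq_iff)
qed

end
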